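(* Let $n\ge1$. Let $g\in\ell^2(\mathbb{Z}^n)$ be a non-zero window function, let $f\in\ell^1(\mathbb{Z}^n)$ be such that $\|V_gf\|_{L^2(\mathbb{Z}^n\times\mathbb{T}^n)}=1$, let $\Sigma\subset\mathbb{Z}^n\times\mathbb{T}^n$ be measurable with $(\nu\otimes\mu)(\Sigma)<\infty$, and let $E\subset\mathbb{Z}^n$ with $\nu(E)<\infty$. Let $0\le\varepsilon_E<1$ and $0\le\varepsilon_\Sigma<1$. If $f$ is $\varepsilon_E$-concentrated on $E$ in $\ell^1(\mathbb{Z}^n)$-norm and $V_gf$ is $\varepsilon_\Sigma$-time-frequency concentrated on $\Sigma$, then $$\nu(E)\ge(1-\varepsilon_E)^2\,\|f\|_{\ell^1(\mathbb{Z}^n)}^2\,\|g\|_{\ell^2(\mathbb{Z}^n)}^2$$ and $$\|f\|_{\ell^2(\mathbb{Z}^n)}^2\,\|g\|_{\ell^2(\mathbb{Z}^n)}^2\,(\nu\otimes\mu)(\Sigma)\ge1-\varepsilon_\Sigma^2.$$ In particular, $$\nu(E)\,(\nu\otimes\mu)(\Sigma)\ge(1-\varepsilon_E)^2\,(1-\varepsilon_\Sigma^2).$$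
   Context: For $f,g\in\ell^2(\mathbb{Z}^n)$ (note $\ell^1(\mathbb{Z}^n)\subset\ell^2(\mathbb{Z}^n)$) the short-time Fourier transform (STFT) of $f$ with window $g$ is the function on $\mathbb{Z}^n\times\mathbb{T}^n$ (where $\mathbb{T}^n=\mathbb{R}^n/\mathbb{Z}^n$) given by $V_gf(m,w)=\sum_{k\in\mathbb{Z}^n}f(k)\,\overline{g(k-m)}\,e^{-2\pi i w\cdot k}$. The measure $\nu\otimes\mu$ on $\mathbb{Z}^n\times\mathbb{T}^n$ is the product of the counting measure $\nu$ on $\mathbb{Z}^n$ and the Lebesgue measure $\mu$ on $\mathbb{T}^n$ (total mass $1$); $L^2(\mathbb{Z}^n\times\mathbb{T}^n)$ is taken with respect to $\nu\otimes\mu$. For $E\subset\mathbb{Z}^n$ and $0\le\varepsilon_E<1$, $f$ is $\varepsilon_E$-concentrated on $E$ in $\ell^1(\mathbb{Z}^n)$-norm if $\|\chi_{E^c}f\|_{\ell^1(\mathbb{Z}^n)}\le\varepsilon_E\|f\|_{\ell^1(\mathbb{Z}^n)}$. For a measurable $\Sigma\subset\mathbb{Z}^n\times\mathbb{T}^n$ and $0\le\varepsilon_\Sigma<1$, $V_gf$ is $\varepsilon_\Sigma$-time-frequency concentrated on $\Sigma$ if $\|\chi_{\Sigma^c}V_gf\|_{L^2(\mathbb{Z}^n\times\mathbb{T}^n)}\le\varepsilon_\Sigma\|V_gf\|_{L^2(\mathbb{Z}^n\times\mathbb{T}^n)}$. Here $\chi$ denotes characteristic functions and $^c$ complements. *)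

theory Defs
  imports "HOL-Analysis.Analysis"
begin

text \<open>
  The lattice \<open>\<int>\<^sup>n\<close> is the type \<^typ>\<open>int ^ 'n\<close>, with \<open>n = CARD('n) \<ge> 1\<close>; the torus
  \<open>\<real>\<^sup>n / \<int>\<^sup>n\<close> is a quotient of \<^typ>\<open>real ^ 'n\<close>.
\<close>

definition lattice_equiv :: "real ^ 'n \<Rightarrow> real ^ 'n \<Rightarrow> bool"
  where "lattice_equiv x y \<longleftrightarrow> (\<forall>i. x $ i - y $ i \<in> \<int>)"

lemma equivp_lattice_equiv: "equivp lattice_equiv"
proof (rule equivpI)
  show "reflp lattice_equiv"
    by (simp add: reflp_def lattice_equiv_def)
  show "symp lattice_equiv"
    unfolding symp_def lattice_equiv_def by (metis Ints_minus minus_diff_eq)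
  show "transp lattice_equiv"
    unfolding transp_def lattice_equiv_def
  proof (intro allI impI)
    fix x y z :: "real ^ 'n" and i
    assume "\<forall>i. x $ i - y $ i \<in> \<int>" "\<forall>i. y $ i - z $ i \<in> \<int>"
    then have "(x $ i - y $ i) + (y $ i - z $ i) \<in> \<int>"
      by (intro Ints_add) auto
    then show "x $ i - z $ i \<in> \<int>"
      by simp
  qed
qed

quotient_type 'n torus = "real ^ 'n" / lattice_equiv
  by (rule equivp_lattice_equiv)

lift_definition to_torus :: "real ^ 'n \<Rightarrow> 'n torus" is "\<lambda>x. x" .

text \<open>
  Lebesgue measure on the torus, of total mass 1: a set is measurable iff its preimage in
  \<open>\<real>\<^sup>n\<close> is Lebesgue measurable, and its measure is that of the part of the preimage lying in
  the fundamental domain \<open>[0,1)\<^sup>n\<close>.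
\<close>

definition torus_measure :: "('n::finite) torus measure"
  where "torus_measure =
    distr (restrict_space lebesgue {x :: real ^ 'n. \<forall>i. 0 \<le> x $ i \<and> x $ i < 1})
      (sigma UNIV {A. to_torus -` A \<in> sets lebesgue}) to_torus"

definition phase_measure :: "((int ^ 'n) \<times> 'n torus) measure"
  where "phase_measure = count_space UNIV \<Otimes>\<^sub>M torus_measure"

text \<open>The character \<open>w \<mapsto> exp (- 2 \<pi> \<i> w \<cdot> k)\<close>, well defined on the torus.\<close>

lift_definition torus_char :: "int ^ 'n \<Rightarrow> 'n torus \<Rightarrow> complex"
  is "\<lambda>k w. exp (- 2 * of_real pi * \<i> * of_real (\<Sum>i\<in>UNIV. w $ i * of_int (k $ i)))"
proof -
  fix k :: "int ^ 'n" and x y :: "real ^ 'n"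
  assume "lattice_equiv x y"
  then have "(\<Sum>i\<in>UNIV. (x $ i - y $ i) * of_int (k $ i)) \<in> \<int>"
    by (intro Ints_sum Ints_mult Ints_of_int) (simp add: lattice_equiv_def)
  then obtain j where "(\<Sum>i\<in>UNIV. (x $ i - y $ i) * of_int (k $ i)) = of_int j"
    by (elim Ints_cases)
  then have eq: "(\<Sum>i\<in>UNIV. x $ i * of_int (k $ i))
      = (\<Sum>i\<in>UNIV. y $ i * of_int (k $ i)) + of_int j"
    by (simp add: left_diff_distrib sum_subtractf)
  show "exp (- 2 * of_real pi * \<i> * of_real (\<Sum>i\<in>UNIV. x $ i * of_int (k $ i)))
      = exp (- 2 * of_real pi * \<i> * of_real (\<Sum>i\<in>UNIV. y $ i * of_int (k $ i)))"
    unfolding eq exp_eq by (intro exI[of _ "- j"]) (simp add: algebra_simps)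
qed

definition in_l1 :: "('a \<Rightarrow> complex) \<Rightarrow> bool"
  where "in_l1 f \<longleftrightarrow> (\<lambda>k. norm (f k)) summable_on UNIV"

definition in_l2 :: "('a \<Rightarrow> complex) \<Rightarrow> bool"
  where "in_l2 f \<longleftrightarrow> (\<lambda>k. (norm (f k))\<^sup>2) summable_on UNIV"

definition l1_norm :: "('a \<Rightarrow> complex) \<Rightarrow> real"
  where "l1_norm f = (\<Sum>\<^sub>\<infinity>k. norm (f k))"

definition l2_norm :: "('a \<Rightarrow> complex) \<Rightarrow> real"
  where "l2_norm f = sqrt (\<Sum>\<^sub>\<infinity>k. (norm (f k))\<^sup>2)"

text \<open>
  The Bochner integral is 0 when the integrand is not integrable, so \<open>L2_norm M F\<close> is the
  \<open>L\<^sup>2\<close>-norm of \<open>F\<close> only for square-integrable \<open>F\<close>. A nonzero value entails square-integrability.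
\<close>

definition L2_norm :: "'a measure \<Rightarrow> ('a \<Rightarrow> complex) \<Rightarrow> real"
  where "L2_norm M F = sqrt (\<integral>x. (norm (F x))\<^sup>2 \<partial>M)"

definition stft :: "(int ^ 'n \<Rightarrow> complex) \<Rightarrow> (int ^ 'n \<Rightarrow> complex) \<Rightarrow> (int ^ 'n) \<times> 'n torus \<Rightarrow> complex"
  where "stft g f = (\<lambda>(m, w). \<Sum>\<^sub>\<infinity>k. f k * cnj (g (k - m)) * torus_char k w)"

definition l1_concentrated :: "real \<Rightarrow> 'a set \<Rightarrow> ('a \<Rightarrow> complex) \<Rightarrow> bool"
  where "l1_concentrated \<epsilon> E f \<longleftrightarrow> l1_norm (\<lambda>k. indicator (- E) k * f k) \<le> \<epsilon> * l1_norm f"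

definition tf_concentrated ::
    "real \<Rightarrow> ((int ^ 'n) \<times> 'n torus) set \<Rightarrow> ((int ^ 'n) \<times> 'n torus \<Rightarrow> complex) \<Rightarrow> bool"
  where "tf_concentrated \<epsilon> S F \<longleftrightarrow>
    L2_norm phase_measure (\<lambda>z. indicator (- S) z * F z) \<le> \<epsilon> * L2_norm phase_measure F"

end

theory Submission
  imports Defs
begin

text \<open>
  For fixed \<open>m\<close> the function \<open>w \<mapsto> V\<^sub>gf(m,w)\<close> is an absolutely convergent Fourier series with
  coefficients \<open>f(k) cnj (g(k-m))\<close>. Bessel's inequality, summed over \<open>m\<close>, gives
  \<open>\<parallel>f\<parallel>\<^sub>2 \<parallel>g\<parallel>\<^sub>2 \<le> \<parallel>V\<^sub>gf\<parallel>\<^sub>2 = 1\<close>; the reverse inequality is not needed. The bound on \<open>\<nu>(E)\<close> follows from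
  Cauchy--Schwarz, \<open>\<parallel>\<chi>\<^sub>E f\<parallel>\<^sub>1 \<le> \<nu>(E)\<^sup>1\<^sup>/\<^sup>2 \<parallel>f\<parallel>\<^sub>2\<close>, and the bound on the measure of \<open>\<Sigma>\<close> from
  \<open>\<bar>V\<^sub>gf\<bar> \<le> \<parallel>f\<parallel>\<^sub>2 \<parallel>g\<parallel>\<^sub>2\<close>. Their product is the last claim because \<open>\<parallel>f\<parallel>\<^sub>2 \<le> \<parallel>f\<parallel>\<^sub>1\<close>.
\<close>

section \<open>Orthogonality of exponentials on the unit cube\<close>

text \<open>For a nonzero integer \<open>a\<close> the antiderivative
  \<open>exp (of_real x * c) / c\<close> takes equal values at 0 and 1, because \<open>c\<close> is
  a period of the exponential.\<close>

lemma integral_cis_unit_interval: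
  fixes a :: real
  assumes "a \<in> \<int>"
  shows "(LBINT x:{0..<1}. cis (2 * pi * (x * a))) = (if a = 0 then 1 else 0)"
proof (cases "a = 0")
  case True
  then show ?thesis by (simp add: set_lebesgue_integral_def)
next
  case False
  define c where "c = \<i> * of_real (2 * pi * a)"
  have c: "c \<noteq> 0" using False by (simp add: c_def)
  have cis_eq: "cis (2 * pi * (x * a)) = exp (of_real x * c)" for x
    by (simp add: c_def cis_conv_exp algebra_simps)
  have "(LBINT x=ereal 0..ereal 1. exp (of_real x * c)) = exp (of_real 1 * c) / c - exp (of_real 0 * c) / c"
  proof (rule interval_integral_FTC_finite)
    show "continuous_on {min 0 1..max 0 1} (\<lambda>x. exp (of_real x * c))"
      by (intro continuous_intros)
    fix x :: real
    show "((\<lambda>x. exp (of_real x * c) / c) has_vector_derivative exp (of_real x * c))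
        (at x within {min 0 1..max 0 1})"
      by (rule has_vector_derivative_real_field) (use c in \<open>auto intro!: derivative_eq_intros\<close>)
  qed
  moreover have "exp c = 1"
  proof -
    obtain j where "a = of_int j" using assms by (elim Ints_cases)
    then show ?thesis
      unfolding c_def exp_eq_1 by (auto simp: mult_ac)
  qed
  ultimately show ?thesis
    using False interval_integral_Ico[of 0 1 "\<lambda>x. exp (of_real x * c)"] by (simp add: cis_eq)
qed

text \<open>The integrand, cut off to the cube, is a product of functions of one coordinate each, so
  Fubini leaves a product of one-dimensional integrals. A factor vanishes as soon as one coordinate
  of \<open>K\<close> is nonzero.\<close>

lemma integral_cis_unit_cube:
  fixes K :: "'a::euclidean_space"
  assumes K: "\<And>b. b \<in> Basis \<Longrightarrow> K \<bullet> b \<in> \<int>"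
  shows "(LBINT w:{w. \<forall>b\<in>Basis. 0 \<le> w \<bullet> b \<and> w \<bullet> b < 1}. cis (2 * pi * (w \<bullet> K))) = (if K = 0 then 1 else 0)"
proof -
  let ?f = "\<lambda>b x. indicator {0..<1} x *\<^sub>R cis (2 * pi * (x * (K \<bullet> b)))"
  have cis_sum: "cis (sum g A) = (\<Prod>i\<in>A. cis (g i))" if "finite A" for g and A :: "'a set"
    using that by (induction rule: finite_induct) (simp_all flip: cis_mult)
  have ind: "indicator {w. \<forall>b\<in>Basis. 0 \<le> w \<bullet> b \<and> w \<bullet> b < 1} w
      = (\<Prod>b\<in>Basis. indicator {0..<1::real} (w \<bullet> b) :: real)" for w :: 'a
    by (auto simp: indicator_def split: if_splits)
  have factor: "indicator {w. \<forall>b\<in>Basis. 0 \<le> w \<bullet> b \<and> w \<bullet> b < 1} w *\<^sub>R cis (2 * pi * (w \<bullet> K))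
      = (\<Prod>b\<in>Basis. ?f b (w \<bullet> b))" for w :: 'a
  proof -
    have "cis (2 * pi * (w \<bullet> K)) = (\<Prod>b\<in>Basis. cis (2 * pi * ((w \<bullet> b) * (K \<bullet> b))))"
      by (subst euclidean_inner) (simp add: sum_distrib_left cis_sum)
    then show ?thesis
      unfolding ind by (simp add: scaleR_conv_of_real prod.distrib)
  qed
  have meas: "?f b \<in> borel_measurable borel" for b
    by (intro borel_measurable_scaleR borel_measurable_indicator
        borel_measurable_continuous_onI[of "\<lambda>x. cis (2 * pi * (x * (K \<bullet> b)))"] continuous_intros) auto
  have int: "integrable lborel (?f b)" for b
    by (rule integrableI_bounded_set_indicator[where B = 1])
      (auto intro!: borel_measurable_continuous_onI continuous_intros)
  interpret product_sigma_finite "\<lambda>_::'a. lborel :: real measure"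
    by standard
  have "(LBINT w:{w. \<forall>b\<in>Basis. 0 \<le> w \<bullet> b \<and> w \<bullet> b < 1}. cis (2 * pi * (w \<bullet> K)))
      = (LBINT w. (\<Prod>b\<in>Basis. ?f b (w \<bullet> b)))"
    unfolding set_lebesgue_integral_def factor ..
  also have "\<dots> = (\<integral>x. (\<Prod>b\<in>Basis. ?f b (x b)) \<partial>(\<Pi>\<^sub>M b\<in>Basis. lborel))"
    unfolding lborel_eq[where 'a = 'a]
    by (subst integral_distr) (auto intro!: borel_measurable_prod measurable_compose[OF _ meas])
  also have "\<dots> = (\<Prod>b\<in>Basis. LBINT x. ?f b x)"
    by (intro product_integral_prod int) auto
  also have "\<dots> = (\<Prod>b\<in>Basis. if K \<bullet> b = 0 then 1 else 0)"
    using integral_cis_unit_interval K by (intro prod.cong) (auto simp: set_lebesgue_integral_def)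
  also have "\<dots> = (if K = 0 then 1 else 0)"
    using euclidean_all_zero_iff[of K] by auto
  finally show ?thesis .
qed

section \<open>The torus: measurable sets, measure and characters\<close>

text \<open>Preimages commute with complements and countable unions, so the sets with Lebesgue
  measurable preimage already form a sigma-algebra and \<open>sigma\<close> adds nothing to
  them.\<close>

lemma sets_torus: "sets (torus_measure :: 'n::finite torus measure) = {A. to_torus -` A \<in> sets lebesgue}"
proof -
  let ?S = "{A :: 'n torus set. to_torus -` A \<in> sets lebesgue}"
  have "sigma_algebra UNIV ?S"
    unfolding sigma_algebra_iff2
    by (auto simp: vimage_UN vimage_Compl Compl_in_sets_lebesgue simp flip: Compl_eq_Diff_UNIV)
  then show ?thesis
    by (simp add: torus_measure_def sigma_algebra.sigma_sets_eq)
qed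

lemma space_torus [simp]: "space (torus_measure :: 'n::finite torus measure) = UNIV"
  by (simp add: torus_measure_def space_measure_of_conv)

abbreviation fundamental_cube :: "(real ^ 'n) set"
  where "fundamental_cube \<equiv> {x. \<forall>i. 0 \<le> x $ i \<and> x $ i < 1}"

lemma fundamental_cube_borel: "(fundamental_cube :: (real ^ 'n) set) \<in> sets borel"
  by measurable

lemma to_torus_measurable:
  "to_torus \<in> restrict_space lebesgue fundamental_cube \<rightarrow>\<^sub>M (sigma UNIV {A. to_torus -` A \<in> sets lebesgue} :: 'n::finite torus measure)"
  by (rule measurable_measure_of)
    (auto simp: sets_restrict_space space_restrict_space fundamental_cube_borel)

lemma sets_torus_sigma: "sets (sigma UNIV {A. to_torus -` A \<in> sets lebesgue}) = sets (torus_measure :: 'n::finite torus measure)"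
  by (simp add: torus_measure_def)

lemma finite_measure_torus: "finite_measure (torus_measure :: 'n::finite torus measure)"
proof -
  have "(fundamental_cube :: (real ^ 'n) set) \<subseteq> cbox 0 1"
    by (auto simp: mem_box_cart less_imp_le)
  then have "emeasure lborel (fundamental_cube :: (real ^ 'n) set) \<le> emeasure lborel (cbox 0 1 :: (real ^ 'n) set)"
    by (intro emeasure_mono) auto
  also have "\<dots> < \<infinity>"
    using emeasure_lborel_cbox_finite by auto
  finally have "finite_measure (restrict_space lebesgue (fundamental_cube :: (real ^ 'n) set))"
    using fundamental_cube_borel
    by (intro finite_measureI) (simp add: emeasure_restrict_space space_restrict_space)
  then show ?thesis
    unfolding torus_measure_def
    by (rule finite_measure.finite_measure_distr) (rule to_torus_measurable)
qed

text \<open>The minus sign of the character is absorbed into the frequency vector, which gives the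
  integrand of \<open>integral_cis_unit_cube\<close>.\<close>

lemma torus_char_to_torus:
  "torus_char k (to_torus w) = cis (2 * pi * (w \<bullet> (\<chi> i. - real_of_int (k $ i))))"
  by transfer (simp add: cis_conv_exp inner_vec_def sum_negf mult_ac)

lemma norm_torus_char [simp]: "norm (torus_char k w) = 1"
  by transfer (simp add: norm_exp_eq_Re)

lemma torus_char_mult_cnj: "torus_char k w * cnj (torus_char l w) = torus_char (k - l) w"
  by transfer
    (simp add: exp_cnj exp_add[symmetric] algebra_simps sum_subtractf)

lemma torus_char_measurable [measurable]: "torus_char k \<in> borel_measurable torus_measure"
proof (rule measurableI)
  fix A :: "complex set" assume A: "A \<in> sets borel"
  \<comment> \<open>Measurability on the torus is tested on the preimage in Euclidean space, where
    the character is continuous.\<close>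
  have "(\<lambda>w. torus_char k (to_torus w)) \<in> borel_measurable borel"
    unfolding torus_char_to_torus
    by (intro borel_measurable_continuous_onI continuous_intros)
  from measurable_sets[OF this A] have "to_torus -` (torus_char k -` A) \<in> sets borel"
    by (simp add: vimage_def)
  then show "torus_char k -` A \<inter> space torus_measure \<in> sets torus_measure"
    by (simp add: sets_torus)
qed simp

lemma integral_torus_char: "(\<integral>w. torus_char k w \<partial>torus_measure) = (if k = 0 then 1 else 0)"
proof -
  let ?K = "\<chi> i. - real_of_int (k $ i)"
  have cube: "fundamental_cube = {w :: real ^ 'n. \<forall>b\<in>Basis. 0 \<le> w \<bullet> b \<and> w \<bullet> b < 1}"
    by (auto simp: Basis_vec_def inner_axis)
  have "(\<integral>w. torus_char k w \<partial>torus_measure)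
      = (\<integral>w. torus_char k (to_torus w) \<partial>restrict_space lebesgue fundamental_cube)"
    unfolding torus_measure_def
    by (rule integral_distr[OF to_torus_measurable])
      (use torus_char_measurable in \<open>simp cong: measurable_cong_sets add: sets_torus_sigma\<close>)
  also have "\<dots> = (\<integral>w. indicator fundamental_cube w *\<^sub>R cis (2 * pi * (w \<bullet> ?K)) \<partial>lebesgue)"
    by (subst integral_restrict_space) (auto simp: fundamental_cube_borel torus_char_to_torus)
  \<comment> \<open>\<open>lebesgue\<close> is the completion of \<open>lborel\<close>, and a Borel
    function has the same integral for both.\<close>
  also have "\<dots> = (LBINT w:fundamental_cube. cis (2 * pi * (w \<bullet> ?K)))"
    unfolding set_lebesgue_integral_def
    by (intro integral_completion borel_measurable_scaleR borel_measurable_indicator)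
      (auto intro!: borel_measurable_continuous_onI continuous_intros fundamental_cube_borel)
  also have "\<dots> = (if ?K = 0 then 1 else 0)"
    unfolding cube by (rule integral_cis_unit_cube) (auto simp: Basis_vec_def inner_axis)
  also have "?K = 0 \<longleftrightarrow> k = 0"
    by (simp add: vec_eq_iff)
  finally show ?thesis .
qed

lemma integrable_torus_char: "integrable torus_measure (torus_char k)"
  using finite_measure_torus by (rule finite_measure.integrable_const_bound[where B = 1]) auto

section \<open>Parseval for trigonometric polynomials and Bessel's inequality\<close>

text \<open>The square expands into a double sum of characters \<open>torus_char (k - l)\<close>, of
  which only the diagonal survives integration. The computation runs over the complex numbers
  because the single terms need not be real.\<close>

lemma integral_norm_trig_poly_square:
  fixes c :: "int ^ 'n \<Rightarrow> complex"
  assumes "finite F"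
  shows "integrable torus_measure (\<lambda>w. (norm (\<Sum>k\<in>F. c k * torus_char k w))\<^sup>2)"
    and "(\<integral>w. (norm (\<Sum>k\<in>F. c k * torus_char k w))\<^sup>2 \<partial>torus_measure) = (\<Sum>k\<in>F. (norm (c k))\<^sup>2)"
proof -
  have expand: "complex_of_real ((norm (\<Sum>k\<in>F. c k * torus_char k w))\<^sup>2)
      = (\<Sum>k\<in>F. \<Sum>l\<in>F. c k * cnj (c l) * torus_char (k - l) w)" for w
    unfolding complex_norm_square
    by (simp add: sum_product torus_char_mult_cnj[symmetric] mult_ac)
  have int: "integrable torus_measure (\<lambda>w. complex_of_real ((norm (\<Sum>k\<in>F. c k * torus_char k w))\<^sup>2))"
    unfolding expand by (intro Bochner_Integration.integrable_sum integrable_mult_right integrable_torus_char)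
  then show "integrable torus_measure (\<lambda>w. (norm (\<Sum>k\<in>F. c k * torus_char k w))\<^sup>2)"
    by (simp only: complex_of_real_integrable_eq)
  have "complex_of_real (\<integral>w. (norm (\<Sum>k\<in>F. c k * torus_char k w))\<^sup>2 \<partial>torus_measure)
      = (\<Sum>k\<in>F. \<Sum>l\<in>F. c k * cnj (c l) * (if k - l = 0 then 1 else 0))"
    unfolding integral_complex_of_real[symmetric] expand
    by (simp add: integral_sum integrable_torus_char integral_torus_char del: right_minus_eq)
  also have "\<dots> = (\<Sum>k\<in>F. c k * cnj (c k))"
    using assms by (simp add: if_distrib sum.delta cong: if_cong)
  also have "\<dots> = complex_of_real (\<Sum>k\<in>F. (norm (c k))\<^sup>2)"
    by (simp add: complex_norm_square del: of_real_power)
  finally show "(\<integral>w. (norm (\<Sum>k\<in>F. c k * torus_char k w))\<^sup>2 \<partial>torus_measure) = (\<Sum>k\<in>F. (norm (c k))\<^sup>2)"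
    by (simp only: of_real_eq_iff)
qed


text \<open>
  The uniform error \<open>r G\<close> of the partial sum over \<open>G\<close> lets \<open>G\<close> tend to \<open>\<int>\<^sup>n\<close> along the net of finite
  sets, where dominated convergence, a statement on sequences, does not apply.
\<close>

lemma bessel_torus:
  fixes h :: "int ^ 'n \<Rightarrow> complex"
  defines "V \<equiv> \<lambda>w. \<Sum>\<^sub>\<infinity>k. h k * torus_char k w"
  assumes h: "in_l1 h" and F: "finite F"
    and [measurable]: "(\<lambda>w. (norm (V w))\<^sup>2) \<in> borel_measurable torus_measure"
  shows "ennreal (\<Sum>k\<in>F. (norm (h k))\<^sup>2) \<le> (\<integral>\<^sup>+w. ennreal ((norm (V w))\<^sup>2) \<partial>torus_measure)"
    (is "_ \<le> ?I")
proof -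
  interpret finite_measure "torus_measure :: 'n torus measure"
    by (rule finite_measure_torus)
  define H where "H = (\<Sum>\<^sub>\<infinity>k. norm (h k))"
  define r where "r G = H - (\<Sum>k\<in>G. norm (h k))" for G
  define T where "T = measure torus_measure (UNIV :: 'n torus set)"
  have sum: "(\<lambda>k. norm (h k)) summable_on A" for A
    using h unfolding in_l1_def by (rule summable_on_subset_banach) simp
  have sum_abs: "(\<lambda>k. norm (h k * torus_char k w)) summable_on A" for w A
    using sum by (simp add: norm_mult)
  have sum': "(\<lambda>k. h k * torus_char k w) summable_on A" for w A
    using sum_abs by (rule abs_summable_summable)
  have H: "H \<ge> 0"
    unfolding H_def by (intro infsum_nonneg) simp
  have r: "r G \<ge> 0" if "finite G" for G
    unfolding r_def H_def using finite_sum_le_infsum[OF sum that] by simp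
  \<comment> \<open>The difference of the squares factors into a difference of norms, at most the
    tail \<open>r G\<close>, and a sum of norms, at most \<open>2 * H\<close>.\<close>
  have pointwise: "(norm (\<Sum>k\<in>G. h k * torus_char k w))\<^sup>2 \<le> (norm (V w))\<^sup>2 + r G * (2 * H)"
    if G: "finite G" for G w
  proof -
    let ?c = "\<Sum>k\<in>G. h k * torus_char k w"
    have "V w - ?c = (\<Sum>\<^sub>\<infinity>k\<in>UNIV - G. h k * torus_char k w)"
      unfolding V_def using G by (subst infsum_Diff) (auto intro: sum')
    also have "norm \<dots> \<le> (\<Sum>\<^sub>\<infinity>k\<in>UNIV - G. norm (h k))"
      using norm_infsum_bound[OF sum_abs] by (simp add: norm_mult)
    also have "\<dots> = r G"
      unfolding r_def H_def using G by (subst infsum_Diff) (auto intro: sum)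
    finally have d: "norm (V w - ?c) \<le> r G" .
    have V: "norm (V w) \<le> H"
      unfolding V_def H_def using norm_infsum_bound[OF sum_abs] by (simp add: norm_mult)
    have "norm ?c \<le> (\<Sum>k\<in>G. norm (h k))"
      by (rule order_trans[OF norm_sum]) (simp add: norm_mult)
    also have "\<dots> \<le> H"
      using r[OF G] by (simp add: r_def)
    finally have c: "norm ?c \<le> H" .
    have "norm ?c - norm (V w) \<le> r G"
      using d norm_triangle_ineq2[of ?c "V w"] by (simp add: norm_minus_commute)
    then have "(norm ?c - norm (V w)) * (norm ?c + norm (V w)) \<le> r G * (2 * H)"
      using V c r[OF G] by (intro mult_mono) auto
    then show ?thesis
      by (simp add: power2_eq_square algebra_simps)
  qed
  have bound: "ennreal (\<Sum>k\<in>F. (norm (h k))\<^sup>2) \<le> ?I + ennreal (r G * (2 * H) * T)"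
    if G: "finite G" "F \<subseteq> G" for G
  proof -
    have "ennreal (\<Sum>k\<in>F. (norm (h k))\<^sup>2) \<le> ennreal (\<Sum>k\<in>G. (norm (h k))\<^sup>2)"
      using G by (intro ennreal_leI sum_mono2) auto
    also have "\<dots> = (\<integral>\<^sup>+w. ennreal ((norm (\<Sum>k\<in>G. h k * torus_char k w))\<^sup>2) \<partial>torus_measure)"
      using integral_norm_trig_poly_square[OF G(1), of h] by (simp add: nn_integral_eq_integral)
    also have "\<dots> \<le> (\<integral>\<^sup>+w. ennreal ((norm (V w))\<^sup>2) + ennreal (r G * (2 * H)) \<partial>torus_measure)"
      using pointwise[OF G(1)] r[OF G(1)] H
      by (intro nn_integral_mono) (simp flip: ennreal_plus)
    \<comment> \<open>The error is constant in \<open>w\<close>, so it integrates to its multiple of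
      the finite total mass \<open>T\<close>.\<close>
    also have "\<dots> = ?I + ennreal (r G * (2 * H) * T)"
      using r[OF G(1)] H
      by (subst nn_integral_add) (auto simp: T_def emeasure_eq_measure ennreal_mult)
    finally show ?thesis .
  qed
  \<comment> \<open>The limit 0 is left in the form \<open>H - H\<close> that the limit rules
    produce.\<close>
  have "(r \<longlongrightarrow> H - H) (finite_subsets_at_top UNIV)"
    unfolding r_def H_def by (intro tendsto_intros infsum_tendsto sum)
  then have "((\<lambda>G. r G * (2 * H) * T) \<longlongrightarrow> (H - H) * (2 * H) * T) (finite_subsets_at_top UNIV)"
    by (intro tendsto_intros)
  then have "((\<lambda>G. ?I + ennreal (r G * (2 * H) * T)) \<longlongrightarrow> ?I + ennreal ((H - H) * (2 * H) * T))
      (finite_subsets_at_top UNIV)"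
    by (intro tendsto_add tendsto_ennrealI tendsto_const)
  moreover have "\<forall>\<^sub>F G in finite_subsets_at_top UNIV.
      ennreal (\<Sum>k\<in>F. (norm (h k))\<^sup>2) \<le> ?I + ennreal (r G * (2 * H) * T)"
    unfolding eventually_finite_subsets_at_top using F bound by auto
  ultimately have "ennreal (\<Sum>k\<in>F. (norm (h k))\<^sup>2) \<le> ?I + ennreal ((H - H) * (2 * H) * T)"
    by (rule tendsto_lowerbound) simp
  then show ?thesis by simp
qed

section \<open>Norm estimates for summable and square-summable families\<close>

lemma l1_norm_nonneg: "0 \<le> l1_norm f"
  unfolding l1_norm_def by (intro infsum_nonneg) simp

lemma l2_norm_nonneg: "0 \<le> l2_norm f"
  unfolding l2_norm_def by (intro real_sqrt_ge_zero infsum_nonneg) simp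

lemma l2_norm_square: "(l2_norm f)\<^sup>2 = (\<Sum>\<^sub>\<infinity>k. (norm (f k))\<^sup>2)"
  unfolding l2_norm_def by (intro real_sqrt_pow2 infsum_nonneg) simp

lemma norm_le_l1_norm: "in_l1 f \<Longrightarrow> norm (f k) \<le> l1_norm f"
  using finite_sum_le_infsum[of "\<lambda>k. norm (f k)" UNIV "{k}"] by (simp add: in_l1_def l1_norm_def)

lemma norm_le_l2_norm:
  assumes "in_l2 f"
  shows "norm (f k) \<le> l2_norm f"
proof (rule power2_le_imp_le)
  show "(norm (f k))\<^sup>2 \<le> (l2_norm f)\<^sup>2"
    using assms finite_sum_le_infsum[of "\<lambda>k. (norm (f k))\<^sup>2" UNIV "{k}"]
    by (simp add: in_l2_def l2_norm_square)
qed (rule l2_norm_nonneg)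

text \<open>Each value is at most the l1-norm, so the squares are dominated termwise by
  \<open>norm (f k) * l1_norm f\<close>, which sums to the square of the l1-norm.\<close>

lemma in_l2_of_in_l1:
  assumes "in_l1 f"
  shows "in_l2 f" and "l2_norm f \<le> l1_norm f"
proof -
  have le: "(norm (f k))\<^sup>2 \<le> norm (f k) * l1_norm f" for k
    using norm_le_l1_norm[OF assms] by (simp add: power2_eq_square mult_left_mono)
  have s: "(\<lambda>k. norm (f k) * l1_norm f) summable_on UNIV"
    using assms unfolding in_l1_def by (rule summable_on_cmult_left)
  show "in_l2 f"
    unfolding in_l2_def
    by (rule summable_on_comparison_test[OF s le]) simp
  then have "(l2_norm f)\<^sup>2 \<le> (\<Sum>\<^sub>\<infinity>k. norm (f k) * l1_norm f)"
    unfolding l2_norm_square in_l2_def using s le by (intro infsum_mono)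
  also have "\<dots> = (l1_norm f)\<^sup>2"
    using assms unfolding in_l1_def
    by (subst infsum_cmult_left) (auto simp: l1_norm_def power2_eq_square)
  finally show "l2_norm f \<le> l1_norm f"
    by (rule power2_le_imp_le) (rule l1_norm_nonneg)
qed

lemma sum_norm_square_le_l2_norm:
  assumes "in_l2 f" "finite F"
  shows "(\<Sum>k\<in>F. (norm (f k))\<^sup>2) \<le> (l2_norm f)\<^sup>2"
  unfolding l2_norm_square using assms by (intro finite_sum_le_infsum) (auto simp: in_l2_def)

lemma in_l2_shift:
  fixes g :: "'a::ab_group_add \<Rightarrow> complex"
  shows "in_l2 (\<lambda>k. g (k - m)) \<longleftrightarrow> in_l2 g"
  unfolding in_l2_def
  by (rule summable_on_reindex_bij_betw[of "\<lambda>k. k - m" UNIV UNIV "\<lambda>k. (norm (g k))\<^sup>2"])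
    (rule bij_betwI[where g = "\<lambda>k. k + m"], auto)

lemma l2_norm_shift:
  fixes g :: "'a::ab_group_add \<Rightarrow> complex"
  shows "l2_norm (\<lambda>k. g (k - m)) = l2_norm g"
proof -
  have "bij_betw (\<lambda>k. k - m) UNIV UNIV"
    by (rule bij_betwI[where g = "\<lambda>k. k + m"]) auto
  from infsum_reindex_bij_betw[OF this, of "\<lambda>k. (norm (g k))\<^sup>2"] show ?thesis
    by (simp add: l2_norm_def)
qed

text \<open>Cauchy--Schwarz on finite sets, the form that suits infinite sums of nonnegative terms,
  which are bounded through their finite partial sums.\<close>

lemma sum_norm_mult_le_l2_norm:
  assumes "in_l2 f" "in_l2 g" "finite F"
  shows "(\<Sum>k\<in>F. norm (f k) * norm (g k)) \<le> l2_norm f * l2_norm g"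
proof (rule power2_le_imp_le)
  have "(\<Sum>k\<in>F. norm (f k) * norm (g k))\<^sup>2 \<le> (\<Sum>k\<in>F. (norm (f k))\<^sup>2) * (\<Sum>k\<in>F. (norm (g k))\<^sup>2)"
    by (rule Cauchy_Schwarz_ineq_sum)
  also have "\<dots> \<le> (l2_norm f)\<^sup>2 * (l2_norm g)\<^sup>2"
    using assms by (intro mult_mono sum_norm_square_le_l2_norm sum_nonneg) auto
  finally show "(\<Sum>k\<in>F. norm (f k) * norm (g k))\<^sup>2 \<le> (l2_norm f * l2_norm g)\<^sup>2"
    by (simp add: power_mult_distrib)
qed (simp add: l2_norm_nonneg)

section \<open>Pointwise and integral bounds for the short-time Fourier transform\<close>

text \<open>The window is bounded by \<open>l2_norm g\<close>, so the product is dominated by a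
  multiple of \<open>norm (f k)\<close>. Hence the series in \<open>stft\<close> converges
  absolutely and Bessel's inequality applies to it.\<close>

lemma in_l1_window:
  fixes f g :: "int ^ 'n \<Rightarrow> complex"
  assumes "in_l1 f" "in_l2 g"
  shows "in_l1 (\<lambda>k. f k * cnj (g (k - m)))"
proof -
  have "(\<lambda>k. norm (f k) * l2_norm g) summable_on UNIV"
    using assms(1) unfolding in_l1_def by (rule summable_on_cmult_left)
  then show ?thesis
    unfolding in_l1_def
    by (rule summable_on_comparison_test)
      (auto simp: norm_mult intro: mult_left_mono norm_le_l2_norm[OF assms(2)])
qed

text \<open>Characters have modulus 1 and translating \<open>g\<close> keeps its l2-norm, so the
  triangle inequality and Cauchy--Schwarz give a bound independent of \<open>z\<close>.\<close>

lemma norm_stft_le: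
  fixes f g :: "int ^ 'n \<Rightarrow> complex"
  assumes "in_l1 f" "in_l2 g"
  shows "norm (stft g f z) \<le> l2_norm f * l2_norm g"
proof -
  obtain m w where z: "z = (m, w)" by force
  have s: "(\<lambda>k. norm (f k * cnj (g (k - m)) * torus_char k w)) summable_on UNIV"
    using in_l1_window[OF assms, of m] by (simp add: in_l1_def norm_mult)
  have "norm (stft g f z) \<le> (\<Sum>\<^sub>\<infinity>k. norm (f k * cnj (g (k - m)) * torus_char k w))"
    unfolding z stft_def prod.case by (rule norm_infsum_bound[OF s])
  also have "\<dots> \<le> l2_norm f * l2_norm g"
  proof (rule infsum_le_finite_sums[OF s])
    fix F :: "(int ^ 'n) set" assume "finite F"
    then show "(\<Sum>k\<in>F. norm (f k * cnj (g (k - m)) * torus_char k w)) \<le> l2_norm f * l2_norm g"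
      using sum_norm_mult_le_l2_norm[of f "\<lambda>k. g (k - m)" F] assms in_l2_of_in_l1(1)[of f]
      by (simp add: norm_mult in_l2_shift l2_norm_shift)
  qed
  finally show ?thesis .
qed

text \<open>Serves to pass from Bessel's inequality at finitely many \<open>m\<close> to the
  integral over the whole lattice.\<close>

lemma sum_le_nn_integral_count_space:
  fixes \<phi> :: "'a \<Rightarrow> ennreal"
  assumes "finite M"
  shows "sum \<phi> M \<le> (\<integral>\<^sup>+m. \<phi> m \<partial>count_space UNIV)"
proof -
  have "sum \<phi> M = (\<integral>\<^sup>+m. \<phi> m * indicator M m \<partial>count_space UNIV)"
    using assms by (subst nn_integral_count_space'[of M]) auto
  also have "\<dots> \<le> (\<integral>\<^sup>+m. \<phi> m \<partial>count_space UNIV)"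
    by (intro nn_integral_mono) (auto simp: indicator_def)
  finally show ?thesis .
qed

text \<open>At fixed \<open>m\<close>, Bessel's inequality bounds the sum over \<open>k\<close> of
  the squared coefficients by an integral over the torus. Summed over \<open>m\<close> as well, the
  squared coefficients factor under the substitution \<open>j = k - m\<close> into the two squared
  l2-norms.\<close>

lemma l2_norms_le_nn_integral_stft:
  fixes f g :: "int ^ 'n \<Rightarrow> complex"
  assumes f: "in_l1 f" and g: "in_l2 g"
    and meas: "(\<lambda>z. (norm (stft g f z))\<^sup>2) \<in> borel_measurable phase_measure"
  shows "ennreal ((l2_norm f)\<^sup>2 * (l2_norm g)\<^sup>2) \<le> (\<integral>\<^sup>+z. ennreal ((norm (stft g f z))\<^sup>2) \<partial>phase_measure)"
    (is "_ \<le> ?I")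
proof (cases ?I)
  \<comment> \<open>An infinite integral makes the bound trivial, so the argument concerns a finite
    one.\<close>
  case (real I)
  \<comment> \<open>Finiteness supplies the sigma-finiteness that Tonelli's theorem
    (\<open>nn_integral_fst\<close>) requires below.\<close>
  interpret finite_measure "torus_measure :: 'n torus measure"
    by (rule finite_measure_torus)
  let ?a = "\<lambda>k. (norm (f k))\<^sup>2" and ?b = "\<lambda>k. (norm (g k))\<^sup>2"
  have fin: "(\<Sum>k\<in>F. ?a k) * (\<Sum>j\<in>G. ?b j) \<le> I" if F: "finite F" and G: "finite G" for F G
  proof -
    \<comment> \<open>\<open>M\<close> collects all differences, so that \<open>(k, j)\<close> goes
      to \<open>(k - j, k)\<close> injectively from \<open>F \<times> G\<close> into
      \<open>M \<times> F\<close>. Enlarging the image to all of \<open>M \<times> F\<close> adds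
      only nonnegative terms.\<close>
    define M where "M = (\<lambda>(k, j). k - j) ` (F \<times> G)"
    have M: "finite M" using F G by (simp add: M_def)
    have "(\<Sum>k\<in>F. ?a k) * (\<Sum>j\<in>G. ?b j) = (\<Sum>(k, j)\<in>F \<times> G. ?a k * ?b j)"
      by (simp add: sum_product sum.cartesian_product)
    also have "\<dots> = (\<Sum>(m, k)\<in>(\<lambda>(k, j). (k - j, k)) ` (F \<times> G). ?a k * ?b (k - m))"
      by (subst sum.reindex) (auto simp: inj_on_def intro!: sum.cong)
    also have "\<dots> \<le> (\<Sum>(m, k)\<in>M \<times> F. ?a k * ?b (k - m))"
      using M F by (intro sum_mono2) (auto simp: M_def)
    also have "\<dots> = (\<Sum>m\<in>M. \<Sum>k\<in>F. (norm (f k * cnj (g (k - m))))\<^sup>2)"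
      by (simp add: sum.cartesian_product norm_mult power_mult_distrib)
    finally have "ennreal ((\<Sum>k\<in>F. ?a k) * (\<Sum>j\<in>G. ?b j))
        \<le> (\<Sum>m\<in>M. ennreal (\<Sum>k\<in>F. (norm (f k * cnj (g (k - m))))\<^sup>2))"
      by (subst sum_ennreal) (auto intro: sum_nonneg ennreal_leI)
    also have "\<dots> \<le> (\<Sum>m\<in>M. \<integral>\<^sup>+w. ennreal ((norm (stft g f (m, w)))\<^sup>2) \<partial>torus_measure)"
    proof (rule sum_mono)
      fix m
      have "(\<lambda>w. (norm (stft g f (m, w)))\<^sup>2) \<in> borel_measurable torus_measure"
        by (rule measurable_Pair2[OF meas[unfolded phase_measure_def]]) simp
      then show "ennreal (\<Sum>k\<in>F. (norm (f k * cnj (g (k - m))))\<^sup>2)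
          \<le> (\<integral>\<^sup>+w. ennreal ((norm (stft g f (m, w)))\<^sup>2) \<partial>torus_measure)"
        using bessel_torus[OF in_l1_window[OF f g, of m] F] by (simp add: stft_def)
    qed
    also have "\<dots> \<le> (\<integral>\<^sup>+m. \<integral>\<^sup>+w. ennreal ((norm (stft g f (m, w)))\<^sup>2) \<partial>torus_measure \<partial>count_space UNIV)"
      by (rule sum_le_nn_integral_count_space[OF M])
    also have "\<dots> = ?I"
      using nn_integral_fst[OF measurable_compose[OF meas[unfolded phase_measure_def] measurable_ennreal]]
      by (simp add: phase_measure_def)
    finally show ?thesis
      using real by simp
  qed
  have s: "?a summable_on UNIV" "?b summable_on UNIV"
    using in_l2_of_in_l1(1)[OF f] g by (auto simp: in_l2_def)
  \<comment> \<open>The finite sets are exhausted one after the other: first \<open>G\<close> with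
    \<open>F\<close> fixed, then \<open>F\<close>.\<close>
  have "(\<Sum>k\<in>F. ?a k) * (l2_norm g)\<^sup>2 \<le> I" if F: "finite F" for F
  proof -
    have "(\<Sum>k\<in>F. ?a k) * (l2_norm g)\<^sup>2 = (\<Sum>\<^sub>\<infinity>j. (\<Sum>k\<in>F. ?a k) * ?b j)"
      unfolding l2_norm_square using s by (subst infsum_cmult_right) auto
    also have "\<dots> \<le> I"
      using fin[OF F] s by (intro infsum_le_finite_sums summable_on_cmult_right) (auto simp flip: sum_distrib_left)
    finally show ?thesis .
  qed
  then have "(\<Sum>\<^sub>\<infinity>k. ?a k * (l2_norm g)\<^sup>2) \<le> I"
    using s by (intro infsum_le_finite_sums summable_on_cmult_left) (auto simp flip: sum_distrib_right)
  then have "(l2_norm f)\<^sup>2 * (l2_norm g)\<^sup>2 \<le> I"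
    unfolding l2_norm_square[of f] using s by (subst (asm) infsum_cmult_left) auto
  then show ?thesis
    using real by (simp add: ennreal_leI)
qed simp

section \<open>Concentration estimates and the uncertainty principle\<close>

text \<open>At most the fraction \<open>\<epsilon>\<close> of the l1-mass lies outside
  \<open>E\<close>, which bounds the sum over \<open>E\<close> from below. Cauchy--Schwarz against
  the constant 1 on \<open>E\<close> bounds it from above.\<close>

lemma l1_norm_le_card_of_l1_concentrated:
  assumes f: "in_l1 f" and E: "finite E" and conc: "l1_concentrated \<epsilon> E f"
  shows "(1 - \<epsilon>) * l1_norm f \<le> sqrt (card E) * l2_norm f"
proof -
  have s: "(\<lambda>k. norm (f k)) summable_on A" for A
    using f unfolding in_l1_def by (rule summable_on_subset_banach) simp
  have "l1_norm (\<lambda>k. indicator (- E) k * f k) = (\<Sum>\<^sub>\<infinity>k\<in>UNIV - E. norm (f k))"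
    unfolding l1_norm_def by (rule infsum_cong_neutral) (auto simp: indicator_def)
  also have "\<dots> = l1_norm f - (\<Sum>k\<in>E. norm (f k))"
    unfolding l1_norm_def using E by (subst infsum_Diff) (auto intro: s)
  finally have "(1 - \<epsilon>) * l1_norm f \<le> (\<Sum>k\<in>E. norm (f k))"
    using conc by (simp add: l1_concentrated_def algebra_simps)
  also have "\<dots> \<le> sqrt (card E) * l2_norm f"
  proof (rule power2_le_imp_le)
    have "(\<Sum>k\<in>E. norm (f k) * 1)\<^sup>2 \<le> (\<Sum>k\<in>E. (norm (f k))\<^sup>2) * (\<Sum>k\<in>E. 1\<^sup>2)"
      by (rule Cauchy_Schwarz_ineq_sum)
    also have "\<dots> \<le> (l2_norm f)\<^sup>2 * card E"
      using sum_norm_square_le_l2_norm[OF in_l2_of_in_l1(1)[OF f] E]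
      by (simp add: mult_right_mono)
    finally show "(\<Sum>k\<in>E. norm (f k))\<^sup>2 \<le> (sqrt (card E) * l2_norm f)\<^sup>2"
      by (simp add: power_mult_distrib mult.commute)
  qed (simp add: l2_norm_nonneg)
  finally show ?thesis .
qed

theorem theorem3p9:
  fixes f g :: "int ^ 'n \<Rightarrow> complex"
    and E :: "(int ^ 'n) set"
    and S :: "((int ^ 'n) \<times> 'n torus) set"
    and \<epsilon>E \<epsilon>S :: real
  assumes "in_l2 g" and "g \<noteq> (\<lambda>_. 0)"
    and "in_l1 f"
    and "L2_norm phase_measure (stft g f) = 1"
    and "S \<in> sets phase_measure" and "emeasure phase_measure S < \<infinity>"
    and "emeasure (count_space UNIV) E < \<infinity>"
    and "0 \<le> \<epsilon>E" and "\<epsilon>E < 1"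
    and "0 \<le> \<epsilon>S" and "\<epsilon>S < 1"
    and "l1_concentrated \<epsilon>E E f"
    and "tf_concentrated \<epsilon>S S (stft g f)"
  shows "measure (count_space UNIV) E \<ge> (1 - \<epsilon>E)\<^sup>2 * (l1_norm f)\<^sup>2 * (l2_norm g)\<^sup>2
    \<and> (l2_norm f)\<^sup>2 * (l2_norm g)\<^sup>2 * measure phase_measure S \<ge> 1 - \<epsilon>S\<^sup>2
    \<and> measure (count_space UNIV) E * measure phase_measure S \<ge> (1 - \<epsilon>E)\<^sup>2 * (1 - \<epsilon>S\<^sup>2)"
proof (intro conjI)
  let ?V = "\<lambda>z. (norm (stft g f z))\<^sup>2"
  let ?C = "(l2_norm f)\<^sup>2 * (l2_norm g)\<^sup>2"
  note g = assms(1) and f = assms(3) and S = assms(5)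
  have int1: "(\<integral>z. ?V z \<partial>phase_measure) = 1"
    using assms(4) by (simp add: L2_norm_def)
  \<comment> \<open>a non-integrable function would have Bochner integral 0\<close>
  have int: "integrable phase_measure ?V"
  proof (rule ccontr)
    assume "\<not> integrable phase_measure ?V"
    with int1 show False by (simp add: not_integrable_integral_eq)
  qed
  have "ennreal ?C \<le> (\<integral>\<^sup>+z. ennreal (?V z) \<partial>phase_measure)"
    using int by (intro l2_norms_le_nn_integral_stft f g) auto
  then have C: "?C \<le> 1"
    using int int1 by (simp add: nn_integral_eq_integral flip: ennreal_1)
  have E: "finite E"
    using assms(7) by (auto simp: emeasure_count_space split: if_splits)
  have "((1 - \<epsilon>E) * l1_norm f)\<^sup>2 \<le> (sqrt (card E) * l2_norm f)\<^sup>2"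
    using l1_norm_le_card_of_l1_concentrated[OF f E assms(12)] assms(9) l1_norm_nonneg[of f]
    by (intro power_mono) auto
  then have "(1 - \<epsilon>E)\<^sup>2 * (l1_norm f)\<^sup>2 \<le> card E * (l2_norm f)\<^sup>2"
    by (simp add: power_mult_distrib)
  then have "(1 - \<epsilon>E)\<^sup>2 * (l1_norm f)\<^sup>2 * (l2_norm g)\<^sup>2 \<le> card E * (l2_norm f)\<^sup>2 * (l2_norm g)\<^sup>2"
    by (rule mult_right_mono) simp
  \<comment> \<open>The normalization of the transform enters here, through
    \<open>?C \<le> 1\<close>.\<close>
  also have "\<dots> \<le> card E"
    using mult_left_mono[OF C, of "card E"] by (simp add: mult_ac)
  finally show 1: "(1 - \<epsilon>E)\<^sup>2 * (l1_norm f)\<^sup>2 * (l2_norm g)\<^sup>2 \<le> measure (count_space UNIV) E"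
    using E by (simp add: measure_count_space)
  have intS: "integrable phase_measure (\<lambda>z. indicator A z * ?V z)" if "A \<in> sets phase_measure" for A
    using integrable_mult_indicator[OF that int] by simp
  have S': "- S \<in> sets phase_measure"
    using sets.compl_sets[OF S]
    by (simp add: phase_measure_def space_pair_measure Compl_eq_Diff_UNIV)
  \<comment> \<open>The indicator is complex-valued on the left and real on the right; taking only
    the values 0 and 1, it is unchanged by norm and square.\<close>
  have "L2_norm phase_measure (\<lambda>z. indicator (- S) z * stft g f z)
      = sqrt (\<integral>z. indicator (- S) z * ?V z \<partial>phase_measure)"
    unfolding L2_norm_def
    by (intro arg_cong[where f = sqrt] Bochner_Integration.integral_cong) (auto simp: indicator_def)
  then have "sqrt (\<integral>z. indicator (- S) z * ?V z \<partial>phase_measure) \<le> \<epsilon>S"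
    using assms(13) assms(4) by (simp add: tf_concentrated_def)
  then have out: "(\<integral>z. indicator (- S) z * ?V z \<partial>phase_measure) \<le> \<epsilon>S\<^sup>2"
    by (rule sqrt_le_D)
  \<comment> \<open>The total mass 1 splits into the part on \<open>S\<close> and the part outside,
    the latter at most the square of \<open>\<epsilon>S\<close>.\<close>
  have "1 = (\<integral>z. indicator S z * ?V z + indicator (- S) z * ?V z \<partial>phase_measure)"
    unfolding int1[symmetric] by (intro Bochner_Integration.integral_cong) (auto simp: indicator_def)
  also have "\<dots> = (\<integral>z. indicator S z * ?V z \<partial>phase_measure) + (\<integral>z. indicator (- S) z * ?V z \<partial>phase_measure)"
    by (intro Bochner_Integration.integral_add intS S S')
  \<comment> \<open>The uniform bound on the transform replaces \<open>?V\<close> by the constant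
    \<open>?C\<close>, which is integrable on \<open>S\<close> because \<open>S\<close> has finite
    measure.\<close>
  also have "(\<integral>z. indicator S z * ?V z \<partial>phase_measure) \<le> (\<integral>z. indicator S z * ?C \<partial>phase_measure)"
  proof (intro integral_mono intS S mult_left_mono)
    show "integrable phase_measure (\<lambda>z. indicator S z * ?C)"
      using S assms(6) by (intro integrable_mult_left integrable_real_indicator)
    show "?V z \<le> ?C" for z
      using power_mono[OF norm_stft_le[OF f g, of z], of 2] by (simp add: power_mult_distrib)
  qed simp
  also have "\<dots> = ?C * measure phase_measure S"
    using S by (simp add: sets.Int_space_eq2)
  finally show 2: "1 - \<epsilon>S\<^sup>2 \<le> ?C * measure phase_measure S"
    using out by simp
  have "(1 - \<epsilon>E)\<^sup>2 * (1 - \<epsilon>S\<^sup>2) \<le> (1 - \<epsilon>E)\<^sup>2 * (?C * measure phase_measure S)"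
    using 2 by (rule mult_left_mono) simp
  also have "\<dots> = ((1 - \<epsilon>E)\<^sup>2 * (l2_norm f)\<^sup>2 * (l2_norm g)\<^sup>2) * measure phase_measure S"
    by (simp add: mult_ac)
  \<comment> \<open>Raising the l2-norm of \<open>f\<close> to its l1-norm produces the lower bound
    for the size of \<open>E\<close> as a factor.\<close>
  also have "\<dots> \<le> ((1 - \<epsilon>E)\<^sup>2 * (l1_norm f)\<^sup>2 * (l2_norm g)\<^sup>2) * measure phase_measure S"
    using in_l2_of_in_l1(2)[OF f]
    by (intro mult_right_mono mult_left_mono power_mono) (auto simp: l2_norm_nonneg)
  also have "\<dots> \<le> measure (count_space UNIV) E * measure phase_measure S"
    using 1 by (rule mult_right_mono) simp
  finally show "(1 - \<epsilon>E)\<^sup>2 * (1 - \<epsilon>S\<^sup>2) \<le> measure (count_space UNIV) E * measure phase_measure S" .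
qed

end
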